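(* Let $0<\alpha\le\beta$, let $\kappa=\beta/\alpha$ and $R_\kappa = 1+\sqrt{\kappa}$. Let $n,d\ge 1$ be integers, let $\rho>0$, and let $A=(a_{i,j})\in\mathbb{R}_+^{n\times n}$ be a mixing matrix satisfying the assumptions stated in the context. If $f_i\in\mathcal{F}_{\alpha,\beta}$ for all $i=1,\dots,n$, then, with $f(x)=\sum_{i=1}^n f_i(x)$ for $x\in\mathbb{R}^d$ and $F_\rho(\boldsymbol{x})=\sum_{i=1}^n f_i(x_i)+\frac{\rho}{2}\sum_{i=1}^n\sum_{j>i}a_{i,j}\|x_i-x_j\|^2$ for $\boldsymbol{x}=(x_1,\dots,x_n)\in(\mathbb{R}^d)^n\cong\mathbb{R}^{nd}$, the (unique) minimizers satisfy $$\arg\min_{x\in\mathbb{R}^d} f(x)\in B(0,R_\kappa)\subset\mathbb{R}^d,$$ $$\arg\min_{\boldsymbol{x}\in\mathbb{R}^{nd}} F_\rho(\boldsymbol{x})\in B(0,R_\kappa)^n\subset\mathbb{R}^{nd}.$$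
   Context: $\|\cdot\|$ is the Euclidean norm and $B(x,r)=\{y\in\mathbb{R}^d:\|x-y\|\le r\}$. $\mathcal{F}_{\alpha,\beta}$ is the set of continuously differentiable functions $g:\mathbb{R}^d\to\mathbb{R}$ such that: $g$ is $\alpha$-strongly convex (i.e. $g(x)-\frac{\alpha}{2}\|x\|^2$ is convex); $g$ is $\beta$-smooth (i.e. $\|\nabla g(x)-\nabla g(y)\|\le\beta\|x-y\|$ for all $x,y$); $\min_x g(x)=0$; and the minimizer of $g$ lies in $B(0,1)$. Assumptions on $A\in\mathbb{R}_+^{n\times n}$ (entries nonnegative): $A$ is symmetric; all diagonal entries $a_{i,i}$ are strictly positive; $A$ is primitive, i.e. there is an integer $k>0$ such that every entry of $A^k$ is positive. *)

theory Defs
  imports "HOL-Analysis.Analysis"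
begin

definition strongly_convex :: "real \<Rightarrow> (real ^ 'd \<Rightarrow> real) \<Rightarrow> bool" where
  "strongly_convex \<alpha> g \<longleftrightarrow> convex_on UNIV (\<lambda>x. g x - \<alpha> / 2 * (norm x)\<^sup>2)"

abbreviation is_minimizer :: "('a \<Rightarrow> real) \<Rightarrow> 'a \<Rightarrow> bool" where
  "is_minimizer g x \<equiv> is_arg_min g (\<lambda>_. True) x"

abbreviation argmin :: "('a \<Rightarrow> real) \<Rightarrow> 'a" where
  "argmin g \<equiv> arg_min g (\<lambda>_. True)"

text \<open>The function \<open>G\<close> below is the gradient of \<open>g\<close>, which is unique.\<close>

definition F_class :: "real \<Rightarrow> real \<Rightarrow> (real ^ 'd \<Rightarrow> real) set" where
  "F_class \<alpha> \<beta> = {g.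
     (\<exists>G. (\<forall>x. GDERIV g x :> G x) \<and> continuous_on UNIV G \<and>
          (\<forall>x y. norm (G x - G y) \<le> \<beta> * norm (x - y))) \<and>
     strongly_convex \<alpha> g \<and>
     (\<exists>x. is_minimizer g x \<and> g x = 0) \<and>
     (\<forall>x. is_minimizer g x \<longrightarrow> x \<in> cball 0 1)}"

text \<open>The operator \<open>^\<close> on \<open>real ^ 'n ^ 'n\<close> is the entrywise power, so the power with respect
  to the matrix product is defined separately.\<close>

primrec matrix_power :: "real ^ 'n ^ 'n \<Rightarrow> nat \<Rightarrow> real ^ 'n ^ 'n" where
  "matrix_power A 0 = mat 1"
| "matrix_power A (Suc k) = A ** matrix_power A k"

definition primitive_matrix :: "real ^ 'n ^ 'n \<Rightarrow> bool" where
  "primitive_matrix A \<longleftrightarrow> (\<exists>k>0. \<forall>i j. matrix_power A k $ i $ j > 0)"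

definition mixing_matrix :: "real ^ 'n ^ 'n \<Rightarrow> bool" where
  "mixing_matrix A \<longleftrightarrow>
     (\<forall>i j. A $ i $ j \<ge> 0) \<and> transpose A = A \<and> (\<forall>i. A $ i $ i > 0) \<and> primitive_matrix A"

text \<open>The index type carries a linear order, playing the role of \<open>{1, ..., n}\<close>, so that each
  unordered pair of indices is counted once.\<close>

definition penalized_sum ::
  "real \<Rightarrow> real ^ ('n::{finite, linorder}) ^ ('n::{finite, linorder}) \<Rightarrow> ('n \<Rightarrow> real ^ 'd \<Rightarrow> real) \<Rightarrow>
   real ^ 'd ^ ('n::{finite, linorder}) \<Rightarrow> real" where
  "penalized_sum \<rho> A f x =
     (\<Sum>i\<in>UNIV. f i (x $ i)) +
     \<rho> / 2 * (\<Sum>i\<in>UNIV. \<Sum>j\<in>{i<..}. A $ i $ j * (norm (x $ i - x $ j))\<^sup>2)"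

end

theory Submission
  imports Defs
begin

text \<open>Let \<open>P\<close> be the metric projection onto the ball \<open>B(0, R)\<close> with \<open>R = 1 + sqrt \<kappa>\<close>. Smoothness gives
  \<open>g 0 \<le> \<beta>/2\<close> for every \<open>g\<close> in the class, while strong convexity gives \<open>g \<ge> \<beta>/2\<close> on the sphere of
  radius \<open>R\<close>; convexity along rays then shows \<open>g (P x) < g x\<close> for all \<open>x\<close> outside the ball.
  As \<open>P\<close> is nonexpansive, applying it to each block does not increase the coupling term. Hence both
  objectives strictly decrease under \<open>P\<close> outside the (product of) balls, so by compactness a
  minimizer exists, it lies there, and by strict convexity it is unique.\<close>

section \<open>Consequences of strong convexity and smoothness\<close>

lemma strongly_convexD:
  assumes "strongly_convex \<alpha> g" "0 \<le> t" "t \<le> 1"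
  shows "g ((1 - t) *\<^sub>R x + t *\<^sub>R y)
    \<le> (1 - t) * g x + t * g y - \<alpha> / 2 * (t * (1 - t)) * (norm (x - y))\<^sup>2"
proof -
  have "convex_on UNIV (\<lambda>x. g x - \<alpha> / 2 * (norm x)\<^sup>2)"
    using assms by (simp add: strongly_convex_def)
  from convex_onD[OF this assms(2,3), of x y]
  have le: "g ((1 - t) *\<^sub>R x + t *\<^sub>R y) - \<alpha> / 2 * (norm ((1 - t) *\<^sub>R x + t *\<^sub>R y))\<^sup>2
    \<le> (1 - t) * (g x - \<alpha> / 2 * (norm x)\<^sup>2) + t * (g y - \<alpha> / 2 * (norm y)\<^sup>2)"
    by simp
  \<comment> \<open>This identity turns the convexity defect of the subtracted quadratic into the
    explicit gain in \<open>norm (x - y)\<close>.\<close>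
  have "(norm ((1 - t) *\<^sub>R x + t *\<^sub>R y))\<^sup>2
    = (1 - t) * (norm x)\<^sup>2 + t * (norm y)\<^sup>2 - t * (1 - t) * (norm (x - y))\<^sup>2"
    by (simp add: power2_norm_eq_inner inner_simps inner_commute[of y x]) (simp add: algebra_simps)
  with le show ?thesis
    by (simp only:) (simp add: field_simps)
qed

lemma strongly_convex_midpoint_less:
  assumes "strongly_convex \<alpha> g" "0 < \<alpha>" "x \<noteq> y"
  shows "g (midpoint x y) < (g x + g y) / 2"
proof -
  have "midpoint x y = (1 - 1/2) *\<^sub>R x + (1/2) *\<^sub>R y"
    by (simp add: midpoint_def scaleR_add_right)
  then have "g (midpoint x y) \<le> (g x + g y) / 2 - \<alpha> / 8 * (norm (x - y))\<^sup>2"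
    using strongly_convexD[OF assms(1), of "1/2" x y] by (simp add: add_divide_distrib)
  moreover have "\<alpha> / 8 * (norm (x - y))\<^sup>2 > 0"
    using assms by simp
  ultimately show ?thesis by linarith
qed

lemma strongly_convex_midpoint_le:
  assumes "strongly_convex \<alpha> g" "0 < \<alpha>"
  shows "g (midpoint x y) \<le> (g x + g y) / 2"
  using strongly_convex_midpoint_less[OF assms, of x y] by (cases "x = y") auto

text \<open>Compare the minimal value with the value at a point of the segment from \<open>z\<close>
  to \<open>y\<close>: strong convexity bounds the latter, dividing by \<open>t\<close> leaves a
  factor \<open>1 - t\<close>, and letting \<open>t\<close> tend to 0 from the right removes
  it.\<close>

lemma strongly_convex_quadratic_growth:
  assumes "strongly_convex \<alpha> g" "is_minimizer g z"
  shows "\<alpha> / 2 * (norm (y - z))\<^sup>2 \<le> g y - g z"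
proof -
  have le: "\<alpha> / 2 * (1 - t) * (norm (y - z))\<^sup>2 \<le> g y - g z" if "0 < t" "t \<le> 1" for t
  proof -
    have "g z \<le> g ((1 - t) *\<^sub>R z + t *\<^sub>R y)"
      using assms(2) by (simp add: is_arg_min_linorder)
    also have "\<dots> \<le> (1 - t) * g z + t * g y - \<alpha> / 2 * (t * (1 - t)) * (norm (z - y))\<^sup>2"
      using strongly_convexD[OF assms(1), of t z y] that by simp
    finally have "t * (\<alpha> / 2 * (1 - t) * (norm (y - z))\<^sup>2) \<le> t * (g y - g z)"
      by (simp add: algebra_simps norm_minus_commute)
    then show ?thesis
      using that by simp
  qed
  have "((\<lambda>t. \<alpha> / 2 * (1 - t) * (norm (y - z))\<^sup>2) \<longlongrightarrow> \<alpha> / 2 * (1 - 0) * (norm (y - z))\<^sup>2) (at_right 0)"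
    by (intro tendsto_intros)
  moreover have "eventually (\<lambda>t. \<alpha> / 2 * (1 - t) * (norm (y - z))\<^sup>2 \<le> g y - g z) (at_right 0)"
    using le by (auto simp: eventually_at_right_field intro!: exI[of _ 1])
  ultimately show ?thesis
    using tendsto_upperbound by fastforce
qed

lemma GDERIV_minimizer_eq_0:
  assumes "GDERIV g z :> G" "is_minimizer g z"
  shows "G = 0"
proof -
  have "(\<lambda>h. inner h G) = (\<lambda>h. 0)"
    using assms differential_zero_maxmin[of z UNIV g "\<lambda>h. inner h G"]
    by (simp add: gderiv_def is_arg_min_linorder)
  then have "inner G G = 0" by metis
  then show ?thesis by simp
qed

text \<open>The gradient vanishes at \<open>z\<close>, so by Cauchy-Schwarz and the Lipschitz bound
  the slope of \<open>g\<close> along the ray through \<open>y\<close> is at most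
  \<open>\<beta> * t * (norm v)\<^sup>2\<close>. Subtracting the antiderivative of this bound gives
  the nonincreasing function \<phi>, which is compared at 0 and 1.\<close>

lemma smooth_minimizer_upper_bound:
  fixes g :: "'a::real_inner \<Rightarrow> real"
  assumes G: "\<And>x. GDERIV g x :> G x"
    and Lip: "\<And>x y. norm (G x - G y) \<le> \<beta> * norm (x - y)"
    and Gz: "G z = 0"
  shows "g y \<le> g z + \<beta> / 2 * (norm (y - z))\<^sup>2"
proof -
  define v where "v = y - z"
  define \<phi> where "\<phi> t = g (z + t *\<^sub>R v) - \<beta> / 2 * t\<^sup>2 * (norm v)\<^sup>2" for t
  have "\<exists>D. (\<phi> has_real_derivative D) (at t) \<and> D \<le> 0" if "0 \<le> t" for t
  proof (intro exI conjI)
    have "(g has_derivative (\<lambda>h. inner h (G (z + t *\<^sub>R v)))) (at (z + t *\<^sub>R v))"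
      using G by (simp add: gderiv_def)
    moreover have "((\<lambda>t. z + t *\<^sub>R v) has_derivative (\<lambda>s. s *\<^sub>R v)) (at t)"
      by (auto intro!: derivative_eq_intros)
    ultimately have "((\<lambda>t. g (z + t *\<^sub>R v)) has_derivative (\<lambda>s. inner (s *\<^sub>R v) (G (z + t *\<^sub>R v)))) (at t)"
      by (rule has_derivative_compose[rotated])
    then have "((\<lambda>t. g (z + t *\<^sub>R v)) has_real_derivative inner v (G (z + t *\<^sub>R v))) (at t)"
      by (simp add: has_field_derivative_def mult_commute_abs)
    then show "(\<phi> has_real_derivative inner v (G (z + t *\<^sub>R v)) - \<beta> * t * (norm v)\<^sup>2) (at t)"
      unfolding \<phi>_def by (auto intro!: derivative_eq_intros)
    have "inner v (G (z + t *\<^sub>R v)) \<le> norm v * norm (G (z + t *\<^sub>R v) - G z)"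
      using Gz by (simp add: norm_cauchy_schwarz)
    also have "\<dots> \<le> norm v * (\<beta> * norm (t *\<^sub>R v))"
      using Lip[of "z + t *\<^sub>R v" z] by (intro mult_left_mono) simp_all
    also have "\<dots> = \<beta> * t * (norm v)\<^sup>2"
      using that by (simp add: power2_eq_square)
    finally show "inner v (G (z + t *\<^sub>R v)) - \<beta> * t * (norm v)\<^sup>2 \<le> 0"
      by simp
  qed
  then have "\<phi> 1 \<le> \<phi> 0"
    by (intro DERIV_nonpos_imp_nonincreasing[of 0 1 \<phi>]) auto
  then show ?thesis
    by (simp add: \<phi>_def v_def)
qed

section \<open>Values of members of \<open>F_class\<close> at the origin and on the sphere\<close>

lemma F_class_strongly_convex: "g \<in> F_class \<alpha> \<beta> \<Longrightarrow> strongly_convex \<alpha> g"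
  by (simp add: F_class_def)

lemma F_class_continuous_on:
  assumes "g \<in> F_class \<alpha> \<beta>"
  shows "continuous_on S g"
proof -
  obtain G where "\<And>x. GDERIV g x :> G x"
    using assms by (auto simp: F_class_def)
  then have "isCont g x" for x
    by (auto simp: gderiv_def intro: has_derivative_continuous)
  then show ?thesis
    by (simp add: continuous_at_imp_continuous_on)
qed

lemma F_class_minimizer:
  assumes "g \<in> F_class \<alpha> \<beta>"
  obtains z where "is_minimizer g z" "g z = 0" "norm z \<le> 1"
  using assms by (fastforce simp: F_class_def)

text \<open>The origin is within distance 1 of the minimizer, whose value is 0, so the quadratic
  upper bound around the minimizer applies.\<close>

lemma F_class_at_0_le:
  assumes g: "g \<in> F_class \<alpha> \<beta>" and "0 \<le> \<beta>"
  shows "g 0 \<le> \<beta> / 2"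
proof -
  obtain G where G: "\<And>x. GDERIV g x :> G x" "\<And>x y. norm (G x - G y) \<le> \<beta> * norm (x - y)"
    using g by (auto simp: F_class_def)
  obtain z where z: "is_minimizer g z" "g z = 0" "norm z \<le> 1"
    using F_class_minimizer[OF g] .
  have "g 0 \<le> g z + \<beta> / 2 * (norm (0 - z))\<^sup>2"
    by (rule smooth_minimizer_upper_bound[OF G GDERIV_minimizer_eq_0[OF G(1) z(1)]])
  also have "\<dots> \<le> \<beta> / 2 * 1\<^sup>2"
    using z \<open>0 \<le> \<beta>\<close> by (simp add: mult_left_le power_le_one)
  finally show ?thesis by simp
qed

text \<open>This fixes the radius: the minimizer has norm at most 1, so a point of this sphere is at
  least \<open>sqrt (\<beta> / \<alpha>)\<close> away from it, and quadratic growth over that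
  distance yields exactly the bound available at the origin.\<close>

lemma F_class_sphere_ge:
  assumes g: "g \<in> F_class \<alpha> \<beta>" and "0 < \<alpha>" "0 \<le> \<beta>" and y: "norm y = 1 + sqrt (\<beta> / \<alpha>)"
  shows "\<beta> / 2 \<le> g y"
proof -
  obtain z where z: "is_minimizer g z" "g z = 0" "norm z \<le> 1"
    using F_class_minimizer[OF g] .
  have "sqrt (\<beta> / \<alpha>) \<le> norm (y - z)"
    using norm_triangle_ineq2[of y z] y z(3) by linarith
  then have "\<beta> / \<alpha> \<le> (norm (y - z))\<^sup>2"
    by (rule sqrt_le_D)
  then have "\<beta> / 2 \<le> \<alpha> / 2 * (norm (y - z))\<^sup>2"
    using \<open>0 < \<alpha>\<close> by (simp add: field_simps)
  also have "\<dots> \<le> g y"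
    using strongly_convex_quadratic_growth[OF F_class_strongly_convex[OF g] z(1), of y] z(2) by simp
  finally show ?thesis .
qed

section \<open>Projection onto the ball and a criterion for unique minimizers\<close>

lemma closest_point_cball_0:
  fixes x :: "'a::euclidean_space"
  assumes "0 \<le> R" "R < norm x"
  shows "closest_point (cball 0 R) x = (R / norm x) *\<^sub>R x"
\<comment> \<open>Nearest points of a closed convex set are unique, so it suffices that the radial
  point lies in the ball and realizes the distance \<open>norm x - R\<close>, a lower bound by the
  reverse triangle inequality.\<close>
proof (rule sym, rule closest_point_unique)
  have "x - (R / norm x) *\<^sub>R x = (1 - R / norm x) *\<^sub>R x"
    by (simp add: algebra_simps)
  then have "dist x ((R / norm x) *\<^sub>R x) = \<bar>1 - R / norm x\<bar> * norm x"
    by (simp add: dist_norm)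
  also have "\<dots> = norm x - R"
    using assms by (cases "x = 0") (auto simp: field_simps)
  finally have *: "dist x ((R / norm x) *\<^sub>R x) = norm x - R" .
  show "\<forall>z\<in>cball 0 R. dist x ((R / norm x) *\<^sub>R x) \<le> dist x z"
  proof
    fix z :: 'a assume "z \<in> cball 0 R"
    then show "dist x ((R / norm x) *\<^sub>R x) \<le> dist x z"
      using * norm_triangle_ineq2[of x z] by (simp add: dist_norm)
  qed
qed (use assms in auto)

text \<open>The projection is \<open>s *\<^sub>R x\<close>, on the sphere, so its value is at least
  \<open>g 0\<close>. In the strong convexity inequality between 0 and \<open>x\<close>,
  \<open>g 0\<close> may thus be replaced by \<open>g (s *\<^sub>R x)\<close>; the quadratic term
  makes the result strict, and cancelling \<open>s\<close> finishes.\<close>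

lemma F_class_closest_point_less:
  assumes g: "g \<in> F_class \<alpha> \<beta>" and "0 < \<alpha>" "0 \<le> \<beta>" and R: "R = 1 + sqrt (\<beta> / \<alpha>)"
    and x: "x \<notin> cball 0 R"
  shows "g (closest_point (cball 0 R) x) < g x"
proof -
  define s where "s = R / norm x"
  have "0 < R"
    using R assms(2,3) by (simp add: add_pos_nonneg)
  moreover have "R < norm x"
    using x by simp
  ultimately have s: "0 < s" "s < 1" "norm (s *\<^sub>R x) = R" "x \<noteq> 0"
    by (auto simp: s_def divide_less_eq intro!: divide_pos_pos)
  have P: "closest_point (cball 0 R) x = s *\<^sub>R x"
    unfolding s_def using \<open>0 < R\<close> \<open>R < norm x\<close> by (intro closest_point_cball_0) auto
  have "g (s *\<^sub>R x) \<le> (1 - s) * g 0 + s * g x - \<alpha> / 2 * (s * (1 - s)) * (norm x)\<^sup>2"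
    using strongly_convexD[OF F_class_strongly_convex[OF g], of s 0 x] s by simp
  moreover have "\<alpha> / 2 * (s * (1 - s)) * (norm x)\<^sup>2 > 0"
    using s \<open>0 < \<alpha>\<close> by simp
  moreover have "g 0 \<le> g (s *\<^sub>R x)"
    using F_class_at_0_le[OF g \<open>0 \<le> \<beta>\<close>] F_class_sphere_ge[OF g \<open>0 < \<alpha>\<close> \<open>0 \<le> \<beta>\<close>] s(3) R by fastforce
  then have "(1 - s) * g 0 \<le> (1 - s) * g (s *\<^sub>R x)"
    using s by (intro mult_left_mono) auto
  ultimately have "g (s *\<^sub>R x) < (1 - s) * g (s *\<^sub>R x) + s * g x"
    by linarith
  then have "s * g (s *\<^sub>R x) < s * g x"
    by (simp add: left_diff_distrib)
  then show ?thesis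
    using s P by simp
qed

lemma F_class_closest_point_le:
  assumes "g \<in> F_class \<alpha> \<beta>" "0 < \<alpha>" "0 \<le> \<beta>" "R = 1 + sqrt (\<beta> / \<alpha>)"
  shows "g (closest_point (cball 0 R) x) \<le> g x"
  using F_class_closest_point_less[OF assms, of x]
  by (cases "x \<in> cball 0 R") (auto simp: closest_point_self)

text \<open>A minimum over \<open>K\<close> exists by compactness and is global, since
  \<open>P\<close> sends any outside point to a better one in \<open>K\<close>. Two distinct
  minimizers would have a midpoint with a smaller value.\<close>

lemma unique_minimizer_in_compact:
  fixes h :: "'a::real_normed_vector \<Rightarrow> real"
  assumes K: "compact K" "K \<noteq> {}" and h: "continuous_on K h"
    and P: "\<And>x. P x \<in> K" "\<And>x. x \<notin> K \<Longrightarrow> h (P x) < h x"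
    and mid: "\<And>x y. x \<noteq> y \<Longrightarrow> h (midpoint x y) < (h x + h y) / 2"
  shows "\<exists>!x. is_minimizer h x" and "argmin h \<in> K"
proof -
  obtain x where x: "x \<in> K" "\<And>y. y \<in> K \<Longrightarrow> h x \<le> h y"
    using continuous_attains_inf[OF K h] by blast
  have min_x: "h x \<le> h y" for y
    using x(2)[of y] x(2)[OF P(1), of y] P(2)[of y] by (cases "y \<in> K") auto
  have uniq: "y = x" if "is_minimizer h y" for y
  proof (rule ccontr)
    assume "y \<noteq> x"
    moreover have "h y \<le> h x"
      using that by (simp add: is_arg_min_linorder)
    ultimately show False
      using mid[of y x] min_x[of "midpoint y x"] min_x[of y] by auto
  qed
  have ix: "is_minimizer h x"
    using min_x by (simp add: is_arg_min_linorder)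
  with uniq show "\<exists>!x. is_minimizer h x" by blast
  \<comment> \<open>\<open>argmin\<close> is a Hilbert choice, so its location follows only from
    existence together with uniqueness.\<close>
  have "is_minimizer h (argmin h)"
    unfolding arg_min_def using ix by (rule someI)
  with uniq x(1) show "argmin h \<in> K" by metis
qed

section \<open>Compactness and convexity for block vectors\<close>

lemma compact_vec_cball:
  "compact {x :: (real ^ 'd) ^ 'n. \<forall>i. x $ i \<in> cball 0 R}"
proof (rule compact_eq_bounded_closed[THEN iffD2], rule conjI)
  have "norm x \<le> (\<Sum>i\<in>(UNIV::'n set). R)" if "\<forall>i. x $ i \<in> cball 0 R" for x :: "(real ^ 'd) ^ 'n"
  proof -
    have "norm x \<le> (\<Sum>i\<in>UNIV. norm (x $ i))"
      unfolding norm_vec_def by (rule L2_set_le_sum) simp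
    also have "\<dots> \<le> (\<Sum>i\<in>(UNIV::'n set). R)"
      using that by (intro sum_mono) simp
    finally show ?thesis .
  qed
  then show "bounded {x :: (real ^ 'd) ^ 'n. \<forall>i. x $ i \<in> cball 0 R}"
    unfolding bounded_iff by blast
  show "closed {x :: (real ^ 'd) ^ 'n. \<forall>i. x $ i \<in> cball 0 R}"
    unfolding mem_cball by (intro closed_Collect_all closed_Collect_le continuous_intros)
qed

text \<open>Midpoint convexity of the squared norm, applied to the differences \<open>a - c\<close>
  and \<open>b - d\<close>; it makes each coupling term midpoint convex.\<close>

lemma norm_midpoint_diff_squared_le:
  fixes a b c d :: "'a::real_inner"
  shows "(norm (midpoint a b - midpoint c d))\<^sup>2 \<le> ((norm (a - c))\<^sup>2 + (norm (b - d))\<^sup>2) / 2"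
proof -
  have "midpoint a b - midpoint c d = (1/2) *\<^sub>R ((a - c) + (b - d))"
    by (simp add: midpoint_def algebra_simps)
  then have "norm (midpoint a b - midpoint c d) \<le> (norm (a - c) + norm (b - d)) / 2"
    using norm_triangle_ineq[of "a - c" "b - d"] by simp
  then have "(norm (midpoint a b - midpoint c d))\<^sup>2 \<le> ((norm (a - c) + norm (b - d)) / 2)\<^sup>2"
    by (intro power_mono) auto
  also have "\<dots> \<le> ((norm (a - c))\<^sup>2 + (norm (b - d))\<^sup>2) / 2"
    using sum_squares_bound[of "norm (a - c)" "norm (b - d)"]
    by (simp add: power2_eq_square field_simps)
  finally show ?thesis .
qed

section \<open>The sum and the penalized sum\<close>

theorem theorem1:
  fixes \<alpha> \<beta> \<rho> \<kappa> R :: real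
    and A :: "real ^ ('n::{finite, linorder}) ^ ('n::{finite, linorder})"
    and f :: "'n \<Rightarrow> real ^ 'd \<Rightarrow> real"
  assumes "0 < \<alpha>" and "\<alpha> \<le> \<beta>"
    and "\<kappa> = \<beta> / \<alpha>" and "R = 1 + sqrt \<kappa>"
    and "\<rho> > 0"
    and "mixing_matrix A"
    and "\<And>i. f i \<in> F_class \<alpha> \<beta>"
  shows "(\<exists>!x. is_minimizer (\<lambda>x. \<Sum>i\<in>UNIV. f i x) x) \<and>
         argmin (\<lambda>x. \<Sum>i\<in>UNIV. f i x) \<in> cball 0 R \<and>
         (\<exists>!x. is_minimizer (penalized_sum \<rho> A f) x) \<and>
         argmin (penalized_sum \<rho> A f) \<in> {x. \<forall>i. x $ i \<in> cball 0 R}"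
proof -
  define P :: "real ^ 'd \<Rightarrow> real ^ 'd" where "P = closest_point (cball 0 R)"
  have \<beta>: "0 \<le> \<beta>" and R: "R = 1 + sqrt (\<beta> / \<alpha>)"
    using assms(1-4) by auto
  then have "0 \<le> R"
    using assms(1) by simp
  have f_less: "f i (P x) < f i x" if "x \<notin> cball 0 R" for i x
    unfolding P_def by (rule F_class_closest_point_less[OF assms(7,1) \<beta> R that])
  have f_le: "f i (P x) \<le> f i x" for i x
    unfolding P_def by (rule F_class_closest_point_le[OF assms(7,1) \<beta> R])
  have f_mid_less: "f i (midpoint x y) < (f i x + f i y) / 2" if "x \<noteq> y" for i x y
    by (rule strongly_convex_midpoint_less[OF F_class_strongly_convex[OF assms(7)] assms(1) that])
  have f_mid_le: "f i (midpoint x y) \<le> (f i x + f i y) / 2" for i x y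
    by (rule strongly_convex_midpoint_le[OF F_class_strongly_convex[OF assms(7)] assms(1)])
  have f_cont: "continuous_on S (f i)" for S i
    by (rule F_class_continuous_on[OF assms(7)])
  have P_in: "P x \<in> cball 0 R" for x
    unfolding P_def using \<open>0 \<le> R\<close> by (intro closest_point_in_set) auto
  have P_nonexp: "norm (P x - P y) \<le> norm (x - y)" for x y
    using closest_point_lipschitz[of "cball 0 R" x y] \<open>0 \<le> R\<close> by (simp add: P_def dist_norm)
  have A: "0 \<le> A $ i $ j" for i j
    using assms(6) by (simp add: mixing_matrix_def)

  let ?f = "\<lambda>x. \<Sum>i\<in>UNIV. f i x"
  have f_Q: "?f (P x) < ?f x" if "x \<notin> cball 0 R" for x
    using f_less[OF that] by (intro sum_strict_mono) auto
  have f_mid: "?f (midpoint x y) < (?f x + ?f y) / 2" if "x \<noteq> y" for x y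
  proof -
    have "?f (midpoint x y) < (\<Sum>i\<in>UNIV. (f i x + f i y) / 2)"
      using f_mid_less[OF that] by (intro sum_strict_mono) auto
    then show ?thesis
      by (simp add: sum.distrib sum_divide_distrib[symmetric])
  qed
  have f_sum_cont: "continuous_on (cball 0 R) ?f"
    by (intro continuous_intros f_cont)
  have ball: "cball 0 R \<noteq> ({} :: (real ^ 'd) set)"
    using \<open>0 \<le> R\<close> by simp
  \<comment> \<open>The criterion with the single ball and \<open>P\<close> settles the sum of the
    \<open>f i\<close>.\<close>
  note unique_minimizer_in_compact[OF compact_cball ball f_sum_cont P_in f_Q f_mid]

  moreover
  let ?F = "penalized_sum \<rho> A f"
  let ?K = "{x :: (real ^ 'd, 'n) vec. \<forall>i. x $ i \<in> cball 0 R}"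
  let ?Q = "\<lambda>x :: (real ^ 'd, 'n) vec. \<chi> i. P (x $ i)"
  let ?C = "\<lambda>x :: (real ^ 'd, 'n) vec. \<Sum>i\<in>UNIV. \<Sum>j\<in>{i<..}. A $ i $ j * (norm (x $ i - x $ j))\<^sup>2"
  have C_Q: "?C (?Q x) \<le> ?C x" for x
    by (intro sum_mono mult_left_mono A) (simp add: P_nonexp)
  have C_mid: "?C (midpoint x y) \<le> (?C x + ?C y) / 2" for x y
  proof -
    have nth: "midpoint x y $ i = midpoint (x $ i) (y $ i)" for i
      by (simp add: midpoint_def)
    have "?C (midpoint x y) \<le> (\<Sum>i\<in>UNIV. \<Sum>j\<in>{i<..}.
        A $ i $ j * (((norm (x $ i - x $ j))\<^sup>2 + (norm (y $ i - y $ j))\<^sup>2) / 2))"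
      unfolding nth by (intro sum_mono mult_left_mono A norm_midpoint_diff_squared_le)
    also have "\<dots> = (?C x + ?C y) / 2"
      by (simp add: sum.distrib sum_divide_distrib[symmetric] distrib_left add_divide_distrib)
    finally show ?thesis .
  qed
  have F_Q: "?F (?Q x) < ?F x" if "x \<notin> ?K" for x
  proof -
    obtain i where "x $ i \<notin> cball 0 R"
      using \<open>x \<notin> ?K\<close> by blast
    \<comment> \<open>Only one block need lie outside its ball: that summand drops strictly and the
      others do not increase.\<close>
    then have "(\<Sum>i\<in>UNIV. f i (?Q x $ i)) < (\<Sum>i\<in>UNIV. f i (x $ i))"
      using f_less f_le by (intro sum_strict_mono_ex1) (auto simp del: mem_cball)
    moreover have "\<rho> / 2 * ?C (?Q x) \<le> \<rho> / 2 * ?C x"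
      using C_Q[of x] \<open>\<rho> > 0\<close> by (intro mult_left_mono) auto
    ultimately show ?thesis
      unfolding penalized_sum_def by linarith
  qed
  have F_mid: "?F (midpoint x y) < (?F x + ?F y) / 2" if "x \<noteq> y" for x y
  proof -
    have nth: "midpoint x y $ i = midpoint (x $ i) (y $ i)" for i
      by (simp add: midpoint_def)
    obtain i where "x $ i \<noteq> y $ i"
      using \<open>x \<noteq> y\<close> by (auto simp: vec_eq_iff)
    \<comment> \<open>The vectors may differ in a single block, so strictness comes from that
      summand alone.\<close>
    then have "(\<Sum>i\<in>UNIV. f i (midpoint x y $ i)) < (\<Sum>i\<in>UNIV. (f i (x $ i) + f i (y $ i)) / 2)"
      unfolding nth using f_mid_less f_mid_le by (intro sum_strict_mono_ex1) auto
    also have "\<dots> = ((\<Sum>i\<in>UNIV. f i (x $ i)) + (\<Sum>i\<in>UNIV. f i (y $ i))) / 2"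
      by (simp add: sum.distrib sum_divide_distrib[symmetric])
    finally have "(\<Sum>i\<in>UNIV. f i (midpoint x y $ i))
      < ((\<Sum>i\<in>UNIV. f i (x $ i)) + (\<Sum>i\<in>UNIV. f i (y $ i))) / 2" .
    moreover have "\<rho> / 2 * ?C (midpoint x y) \<le> \<rho> / 2 * ((?C x + ?C y) / 2)"
      using C_mid[of x y] \<open>\<rho> > 0\<close> by (intro mult_left_mono) auto
    ultimately show ?thesis
      unfolding penalized_sum_def by (simp add: field_simps)
  qed
  have F_cont: "continuous_on ?K ?F"
    unfolding penalized_sum_def
    by (intro continuous_intros continuous_on_compose2[OF f_cont[of UNIV]]) auto
  have "0 \<in> ?K"
    using \<open>0 \<le> R\<close> by simp
  then have K: "?K \<noteq> {}" by blast
  have Q_in: "?Q x \<in> ?K" for x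
    using P_in by (simp del: mem_cball)
  \<comment> \<open>The same criterion, now with the product of balls and the blockwise
    projection.\<close>
  note unique_minimizer_in_compact[OF compact_vec_cball K F_cont Q_in F_Q F_mid]
  ultimately show ?thesis by blast
qed

end
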